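(* Let $\varepsilon\in(0,\frac1n]$ and $\gamma>0$ be given. For $\delta\in[0,\varepsilon)$ put $\varepsilon_\delta:=\varepsilon-\delta$, and let the penalty parameters $\beta_{\varepsilon_\delta}$ be chosen such that $$\beta_{\varepsilon_\delta}>\Bigl(1-\frac1{2(n-1)}+\frac1{2\gamma}\,n\Bigr)\frac1{2\varepsilon_\delta^2}.$$ A point $(\mathbf x,\mathbf y)\in\Delta^V_\varepsilon$ is a stable global minimizer of the problem $\min\{G(\mathbf x,\mathbf y):(\mathbf x,\mathbf y)\in\Delta^V_{\varepsilon}\}$ (with these penalty parameters) if and only if $\mathbf x=\mathbf x(C)$ for some maximum common clique $C\in\mathcal C_{\mathcal U}$ and $\mathbf y\in\{0,1\}^n$.
   Context: Let $V=\{1,\dots,n\}$. Let $\mathbf e\in\mathbb R^n$ be the all-ones vector, $\mathsf I_n$ the identity, $\mathsf E=\mathbf e\mathbf e^\top$ and $\overline{\mathsf E}=\mathsf E-\frac12\mathsf I_n$. Let $\overline{\mathcal U}$ be the set of all matrices $\mathsf U=\frac12\mathsf I_n+\mathsf A$ with $\mathsf A$ the adjacency matrix of a simple undirected graph on $V$; for $\mathsf U\in\overline{\mathcal U}$ let $\mathcal G(\mathsf U)$ be the graph with adjacency matrix $\mathsf U-\frac12\mathsf I_n$. Fix a nonempty (finite) set $\mathcal U\subseteq\overline{\mathcal U}$. $\mathcal C_{\mathcal U}$ is the set of common cliques: nonempty $C\subseteq V$ that are cliques in $\mathcal G(\mathsf U)$ for every $\mathsf U\in\mathcal U$. A maximum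 common clique is an element of $\mathcal C_{\mathcal U}$ of largest cardinality. For nonempty $S\subseteq V$, $\mathbf x(S)=\frac1{|S|}\sum_{i\in S}\mathbf e_i$ is its characteristic vector ($\mathbf e_i$ the standard basis vectors). $\Delta^V=\{\mathbf x\in\mathbb R^n_+:\mathbf e^\top\mathbf x=1\}$ and, for $0<\varepsilon\le\frac1n$, $\Delta^V_\varepsilon=\{(\mathbf x,\mathbf y)\in\mathbb R^{2n}:\mathbf x\in\Delta^V,\ \varepsilon y_i\le x_i\le y_i\text{ and }0\le y_i\le1\text{ for all }i\in V\}$. For $\beta,\gamma>0$: $g_{\mathsf U}(\mathbf x,\mathbf y)=-\mathbf x^\top\mathsf U\mathbf x+\beta\,\mathbf x^\top(\overline{\mathsf E}-\mathsf U)\mathbf x-\frac1{2\gamma}\|\mathbf y\|^2$ and $G(\mathbf x,\mathbf y)=\max_{\mathsf U\in\mathcal U}g_{\mathsf U}(\mathbf x,\mathbf y)$ (so $G$ depends on $\beta$). Stable global minimizer (for the given $\varepsilon$): $(\mathbf x,\mathbf y)$ is a stable global minimizer if there exists $\bar\delta>0$ such that $\varepsilon_{\bar\delta}=\varepsilon-\bar\delta>0$ and, for every $\delta\in[0,\bar\delta]$, $(\mathbf x,\mathbf y)$ is a global minimizer of $G$ with $\beta=\beta_{\varepsilon_\delta}$ over $\Delta^V_{\varepsilon_\delta}$. *)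

theory Defs
  imports "HOL-Analysis.Analysis"
begin

text \<open>
  The vertex set \<open>V = {1,...,n}\<close> is the universe of a finite type \<open>'n\<close>, so \<open>n = CARD('n)\<close>.
  A simple undirected graph on \<open>V\<close> is given by its set of edges, the edges being
  two-element subsets of \<open>V\<close>.
\<close>

definition simple_graph :: "'n::finite set set \<Rightarrow> bool" where
  "simple_graph E \<longleftrightarrow> (\<forall>e\<in>E. card e = 2)"

definition adjacency_matrix :: "'n::finite set set \<Rightarrow> real^'n^'n" where
  "adjacency_matrix E = (\<chi> i j. if {i, j} \<in> E then 1 else 0)"

definition clique :: "'n::finite set set \<Rightarrow> 'n set \<Rightarrow> bool" where
  "clique E C \<longleftrightarrow> (\<forall>i\<in>C. \<forall>j\<in>C. i \<noteq> j \<longrightarrow> {i, j} \<in> E)"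

definition all_ones :: "real^'n::finite" where
  "all_ones = (\<chi> i. 1)"

definition E_mat :: "real^'n::finite^'n" where
  "E_mat = (\<chi> i j. all_ones $ i * all_ones $ j)"

definition E_bar :: "real^'n::finite^'n" where
  "E_bar = E_mat - (1/2) *\<^sub>R mat 1"

definition U_bar :: "(real^'n::finite^'n) set" where
  "U_bar = {(1/2) *\<^sub>R mat 1 + adjacency_matrix E | E. simple_graph E}"

definition graph_of :: "real^'n::finite^'n \<Rightarrow> 'n set set" where
  "graph_of U = {{i, j} | i j. (U - (1/2) *\<^sub>R mat 1) $ i $ j = 1}"

text \<open>On \<^const>\<open>U_bar\<close>, \<^const>\<open>graph_of\<close> is the graph whose adjacency matrix is \<open>U - I/2\<close>:\<close>

lemma graph_of_adjacency:
  assumes "simple_graph E"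
  shows "graph_of ((1/2) *\<^sub>R mat 1 + adjacency_matrix E) = E"
proof -
  have "graph_of ((1/2) *\<^sub>R mat 1 + adjacency_matrix E) = {{i, j} | i j. {i, j} \<in> E}"
    by (auto simp: graph_of_def adjacency_matrix_def)
  also have "\<dots> = E"
  proof (intro equalityI subsetI)
    fix e assume e: "e \<in> E"
    then have "card e = 2"
      using assms by (simp add: simple_graph_def)
    then obtain i j where "e = {i, j}"
      by (meson card_2_iff)
    then show "e \<in> {{i, j} | i j. {i, j} \<in> E}"
      using e by blast
  qed blast
  finally show ?thesis .
qed

lemma U_bar_graph_of:
  assumes "U \<in> U_bar"
  shows "simple_graph (graph_of U)"
    and "adjacency_matrix (graph_of U) = U - (1/2) *\<^sub>R mat 1"
  using assms by (auto simp: U_bar_def graph_of_adjacency)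

definition common_cliques :: "(real^'n::finite^'n) set \<Rightarrow> 'n set set" where
  "common_cliques \<U> = {C. C \<noteq> {} \<and> (\<forall>U\<in>\<U>. clique (graph_of U) C)}"

definition maximum_common_clique :: "(real^'n::finite^'n) set \<Rightarrow> 'n set \<Rightarrow> bool" where
  "maximum_common_clique \<U> C \<longleftrightarrow> is_arg_max card (\<lambda>D. D \<in> common_cliques \<U>) C"

definition char_vec :: "'n::finite set \<Rightarrow> real^'n" where
  "char_vec S = (1 / real (card S)) *\<^sub>R (\<Sum>i\<in>S. axis i 1)"

definition std_simplex :: "(real^'n::finite) set" where
  "std_simplex = {x. (\<forall>i. 0 \<le> x $ i) \<and> all_ones \<bullet> x = 1}"

definition Delta :: "real \<Rightarrow> ((real^'n::finite) \<times> (real^'n)) set" where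
  "Delta \<epsilon> = {(x, y). x \<in> std_simplex \<and>
     (\<forall>i. \<epsilon> * y $ i \<le> x $ i \<and> x $ i \<le> y $ i \<and> 0 \<le> y $ i \<and> y $ i \<le> 1)}"

definition g :: "real \<Rightarrow> real \<Rightarrow> real^'n::finite^'n \<Rightarrow> real^'n \<Rightarrow> real^'n \<Rightarrow> real" where
  "g \<beta> \<gamma> U x y =
     - (x \<bullet> (U *v x)) + \<beta> * (x \<bullet> ((E_bar - U) *v x)) - 1 / (2 * \<gamma>) * (norm y)\<^sup>2"

text \<open>\<^const>\<open>U_bar\<close> is finite, so the maximum is attained for every nonempty \<open>\<U> \<subseteq> U_bar\<close>:\<close>

lemma finite_U_bar: "finite (U_bar :: (real^'n::finite^'n) set)"
proof -
  have "U_bar = (\<lambda>E. (1/2) *\<^sub>R mat 1 + adjacency_matrix E) ` {E :: 'n set set. simple_graph E}"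
    by (auto simp: U_bar_def)
  moreover have "finite {E :: 'n set set. simple_graph E}"
    by simp
  ultimately show ?thesis
    by (metis finite_imageI)
qed

definition G :: "(real^'n::finite^'n) set \<Rightarrow> real \<Rightarrow> real \<Rightarrow> (real^'n) \<times> (real^'n) \<Rightarrow> real" where
  "G \<U> \<beta> \<gamma> = (\<lambda>(x, y). Max ((\<lambda>U. g \<beta> \<gamma> U x y) ` \<U>))"

text \<open>The penalty parameter is a function of the relaxation parameter: \<open>\<beta> \<epsilon>'\<close> is used with
  \<open>Delta \<epsilon>'\<close>.\<close>

definition stable_global_minimizer ::
  "(real^'n::finite^'n) set \<Rightarrow> (real \<Rightarrow> real) \<Rightarrow> real \<Rightarrow> real \<Rightarrow> (real^'n) \<times> (real^'n) \<Rightarrow> bool" where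
  "stable_global_minimizer \<U> \<beta> \<gamma> \<epsilon> p \<longleftrightarrow>
     (\<exists>\<delta>'>0. \<epsilon> - \<delta>' > 0 \<and>
        (\<forall>\<delta>\<in>{0..\<delta>'}. is_arg_min (G \<U> (\<beta> (\<epsilon> - \<delta>)) \<gamma>) (\<lambda>q. q \<in> Delta (\<epsilon> - \<delta>)) p))"

end

theory Submission imports Defs begin

text \<open>
  On the simplex, \<open>x \<bullet> Ux = 1 - |x|\<^sup>2/2 - N\<^sub>U(x)\<close>, where \<open>N\<^sub>U(x) \<ge> 0\<close> sums \<open>x\<^sub>i x\<^sub>j\<close> over the ordered
  pairs of distinct vertices not adjacent in the graph of \<open>U\<close>. Hence
  \<open>g\<^sub>U(x, y) = -1 + |x|\<^sup>2/2 + (1 + \<beta>) N\<^sub>U(x) - |y|\<^sup>2/(2\<gamma>)\<close>. Let \<open>H\<close> be the intersection of all graphs, so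
  that the common cliques are the cliques of \<open>H\<close>, let \<open>m\<close> be their maximum size, and let \<open>N\<^sub>H\<close> be the
  analogue of \<open>N\<^sub>U\<close> for \<open>H\<close>.

  Everything follows from the bound
  \<open>G(x, y) \<ge> -1 + (|x|\<^sup>2/2 + N\<^sub>H(x)) - m/(2\<gamma>)\<close> on the feasible set, which lets \<open>x\<close> and \<open>y\<close> be treated
  separately. It is obtained by comparing both \<open>N\<^sub>H\<close> and \<open>|y|\<^sup>2\<close> with the single number
  \<open>M = max {x\<^sub>i x\<^sub>j | ij not an edge of H}\<close>. A pair attaining \<open>M\<close> is a nonedge of some \<open>U\<close>, so
  \<open>2M \<le> N\<^sub>U(x)\<close> for this one \<open>U\<close>, whereas \<open>N\<^sub>H(x) \<le> n(n - 1)M\<close>. On the other hand \<open>y\<^sub>i \<le> x\<^sub>i/\<epsilon>\<close> yields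
  \<open>y\<^sub>i y\<^sub>j \<le> M/\<epsilon>\<^sup>2\<close> on nonedges of \<open>H\<close>; the indices with \<open>y\<^sub>i\<^sup>2 > M/\<epsilon>\<^sup>2\<close> therefore form a clique of \<open>H\<close>,
  and \<open>|y|\<^sup>2 \<le> m + nM/\<epsilon>\<^sup>2\<close>. The two summands of the threshold for \<open>\<beta>\<close> pay for these two terms:
  \<open>n/(2\<gamma>)\<close> for the excess of \<open>|y|\<^sup>2\<close>, and \<open>1 - 1/(2(n-1))\<close>, with the help of \<open>1/\<epsilon> \<ge> n\<close>, for \<open>N\<^sub>H\<close>.

  The regularized Motzkin-Straus theorem says that \<open>|x|\<^sup>2/2 + N\<^sub>H(x) \<ge> 1/(2m)\<close> on the simplex, with
  equality only at characteristic vectors of cliques of size \<open>m\<close>. Thus \<open>-1 + 1/(2m) - m/(2\<gamma>)\<close> is a lower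
  bound of \<open>G\<close> for every admissible \<open>\<epsilon>\<close>, and it is attained at the characteristic vector of a
  maximum common clique \<open>C\<close> together with the indicator of \<open>C\<close> as \<open>y\<close>. Such points do not depend on
  \<open>\<epsilon>\<close>, which makes them stable. Conversely, a minimizer attains the bound, so that \<open>x\<close> is a
  characteristic vector of the required kind; then \<open>|y|\<^sup>2 = m\<close>, where \<open>y\<close> vanishes off a set of size
  \<open>m\<close> and is at most 1 on it, so \<open>y\<close> is binary.
\<close>

section \<open>The quadratic form of the complement graph\<close>

definition nonadjacency_matrix :: "'n::finite set set \<Rightarrow> real^'n^'n" where
  "nonadjacency_matrix E = (\<chi> i j. if i \<noteq> j \<and> {i, j} \<notin> E then 1 else 0)"

definition nonedge_form :: "'n::finite set set \<Rightarrow> real^'n \<Rightarrow> real" where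
  "nonedge_form E x = x \<bullet> (nonadjacency_matrix E *v x)"

lemma nonedge_form_sum:
  "nonedge_form E x =
     (\<Sum>(i, j)\<in>UNIV. if i \<noteq> j \<and> {i, j} \<notin> E then x $ i * x $ j else 0)"
proof -
  have "nonedge_form E x = (\<Sum>i\<in>UNIV. \<Sum>j\<in>UNIV. if i \<noteq> j \<and> {i, j} \<notin> E then x $ i * x $ j else 0)"
    unfolding nonedge_form_def inner_vec_def matrix_vector_mult_def nonadjacency_matrix_def
    by (auto simp: sum_distrib_left intro!: sum.cong)
  then show ?thesis
    by (simp add: sum.cartesian_product UNIV_Times_UNIV)
qed

lemma nonedge_form_nonneg:
  assumes "\<And>i. 0 \<le> x $ i"
  shows "0 \<le> nonedge_form E x"
  unfolding nonedge_form_sum by (rule sum_nonneg) (auto simp: assms)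

lemma nonedge_form_ge_pair:
  assumes "\<And>i. 0 \<le> x $ i" and "i \<noteq> j" and "{i, j} \<notin> E"
  shows "2 * (x $ i * x $ j) \<le> nonedge_form E x"
proof -
  let ?f = "\<lambda>(i, j). if i \<noteq> j \<and> {i, j} \<notin> E then x $ i * x $ j else 0"
  have "2 * (x $ i * x $ j) = sum ?f {(i, j), (j, i)}"
    using assms by (simp add: insert_commute)
  also have "\<dots> \<le> sum ?f UNIV"
    by (rule sum_mono2) (auto simp: assms(1) split: if_splits)
  finally show ?thesis
    by (simp add: nonedge_form_sum)
qed

lemma nonedge_form_le:
  fixes x :: "real^'n::finite"
  assumes "\<And>i j. i \<noteq> j \<Longrightarrow> {i, j} \<notin> E \<Longrightarrow> x $ i * x $ j \<le> M" and "0 \<le> M"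
  shows "nonedge_form E x \<le> real CARD('n) * (real CARD('n) - 1) * M"
proof -
  have "nonedge_form E x \<le> (\<Sum>(i::'n, j::'n)\<in>UNIV. if i \<noteq> j then M else 0)"
    unfolding nonedge_form_sum by (rule sum_mono) (auto simp: assms)
  also have "\<dots> = (\<Sum>i::'n\<in>UNIV. \<Sum>j\<in>UNIV. if i \<noteq> j then M else 0)"
    by (simp add: sum.cartesian_product UNIV_Times_UNIV)
  also have "\<dots> = (\<Sum>i::'n\<in>UNIV. \<Sum>j\<in>UNIV. M - (if j = i then M else 0))"
    by (intro sum.cong) auto
  also have "\<dots> = real CARD('n) * (real CARD('n) - 1) * M"
    by (simp add: sum_subtractf algebra_simps)
  finally show ?thesis .
qed

lemma nonedge_form_eq_0:
  assumes "clique E C" and "\<And>i. i \<notin> C \<Longrightarrow> x $ i = 0"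
  shows "nonedge_form E x = 0"
  unfolding nonedge_form_sum using assms by (intro sum.neutral) (auto simp: clique_def)

section \<open>Characteristic vectors in the simplex\<close>

lemma inner_all_ones: "all_ones \<bullet> x = (\<Sum>i\<in>UNIV. x $ i)"
  by (simp add: all_ones_def inner_vec_def)

lemma char_vec_nth: "char_vec S $ i = (if i \<in> S then 1 / real (card S) else 0)"
  by (simp add: char_vec_def axis_def if_distrib sum.delta cong: if_cong)

lemma char_vec_inner: "char_vec S \<bullet> x = (\<Sum>i\<in>S. x $ i) / real (card S)"
  unfolding inner_vec_def
  by (simp add: char_vec_nth if_distrib[of "\<lambda>t. t * _"] sum.If_cases sum_divide_distrib cong: if_cong)

lemma char_vec_inner_self: "S \<noteq> {} \<Longrightarrow> char_vec S \<bullet> char_vec S = 1 / real (card S)"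
  by (simp add: char_vec_inner char_vec_nth)

lemma char_vec_in_std_simplex: "S \<noteq> {} \<Longrightarrow> char_vec S \<in> std_simplex"
  by (simp add: std_simplex_def inner_all_ones char_vec_nth sum.If_cases)

text \<open>
  Among the points of a face of the simplex, the barycentre has the smallest norm; the identity
  measures the distance to it and so gives the equality case as well.
\<close>

lemma norm2_diff_char_vec:
  assumes "x \<in> std_simplex" and "S \<noteq> {}" and "\<And>i. i \<notin> S \<Longrightarrow> x $ i = 0"
  shows "(norm (x - char_vec S))\<^sup>2 = x \<bullet> x - 1 / real (card S)"
proof -
  have "(\<Sum>i\<in>S. x $ i) = (\<Sum>i\<in>UNIV. x $ i)"
    using assms(3) by (intro sum.mono_neutral_left) auto
  then have "char_vec S \<bullet> x = 1 / real (card S)"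
    using assms(1) by (simp add: char_vec_inner std_simplex_def inner_all_ones)
  then show ?thesis
    using char_vec_inner_self[OF assms(2)]
    by (simp add: power2_norm_eq_inner inner_diff_left inner_diff_right inner_commute)
qed

section \<open>The regularized Motzkin-Straus theorem\<close>

text \<open>
  On the simplex this is \<open>1 - x \<bullet> (A + I/2) x\<close> for the adjacency matrix \<open>A\<close> of a simple graph. The
  weight 1/2 on the diagonal is what makes the form strictly concave along
  exchanges between nonadjacent vertices while keeping it strictly convex on cliques; both are
  responsible for the uniqueness of the minimizers.
\<close>

definition regularized_form :: "'n::finite set set \<Rightarrow> real^'n \<Rightarrow> real" where
  "regularized_form E x = (x \<bullet> x) / 2 + nonedge_form E x"

text \<open>
  Shifting mass between nonadjacent vertices \<open>i\<close> and \<open>j\<close> changes the form by a strictly concave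
  polynomial: the squared norm contributes \<open>+t\<^sup>2\<close>, the product \<open>x\<^sub>i x\<^sub>j\<close>, counted twice, \<open>-2t\<^sup>2\<close>.
  Only the sign of the linear coefficient \<open>L\<close> matters later.
\<close>

lemma regularized_form_move:
  fixes x :: "real^'n::finite"
  assumes "i \<noteq> j" and "{i, j} \<notin> E"
  obtains L where "\<And>t. regularized_form E (x + t *\<^sub>R (axis i 1 - axis j 1))
                      = regularized_form E x + t * L - t\<^sup>2"
proof -
  define A where "A = nonadjacency_matrix E"
  define d :: "real^'n" where "d = axis i 1 - axis j 1"
  have tr: "transpose A = A"
    by (simp add: A_def nonadjacency_matrix_def transpose_def vec_eq_iff insert_commute eq_commute)
  have sym: "u \<bullet> (A *v v) = v \<bullet> (A *v u)" for u v
    by (metis tr dot_lmul_matrix inner_commute transpose_matrix_vector)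
  have dd: "d \<bullet> d = 2"
    using assms(1) by (simp add: d_def inner_diff_left inner_diff_right inner_axis_axis)
  have entry: "axis k 1 \<bullet> (A *v axis l 1) = A $ k $ l" for k l
    by (simp add: inner_axis' matrix_vector_mult_basis column_def)
  have dAd: "d \<bullet> (A *v d) = - 2"
    using assms
    by (simp add: d_def matrix_vector_mult_diff_distrib inner_diff_left inner_diff_right entry)
      (simp add: A_def nonadjacency_matrix_def insert_commute)
  have "regularized_form E (x + t *\<^sub>R d)
      = regularized_form E x + t * (x \<bullet> d + 2 * (d \<bullet> (A *v x))) - t\<^sup>2" for t
    unfolding regularized_form_def nonedge_form_def A_def[symmetric]
    using dd dAd sym[of x d]
    by (simp add: matrix_vector_right_distrib matrix_vector_mult_scaleR inner_add_left
        inner_add_right inner_commute[of d x] power2_eq_square algebra_simps)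
  then show thesis
    using that unfolding d_def by blast
qed

text \<open>
  A strictly concave function on a segment is smaller at one of the endpoints, and at an endpoint one
  of the two vertices has lost all its mass.
\<close>

lemma regularized_form_shrink_support:
  fixes x :: "real^'n::finite"
  assumes x: "x \<in> std_simplex" and nc: "\<not> clique E {i. x $ i \<noteq> 0}"
  obtains x' where "x' \<in> std_simplex" "{i. x' $ i \<noteq> 0} \<subset> {i. x $ i \<noteq> 0}"
    "regularized_form E x' < regularized_form E x"
proof -
  obtain i j where ij: "i \<noteq> j" "{i, j} \<notin> E" "x $ i \<noteq> 0" "x $ j \<noteq> 0"
    using nc by (auto simp: clique_def)
  have nonneg: "0 \<le> x $ k" for k
    using x by (simp add: std_simplex_def)
  have pos: "0 < x $ i" "0 < x $ j"
    using ij nonneg by (simp_all add: order_less_le)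
  obtain L where L: "\<And>t. regularized_form E (x + t *\<^sub>R (axis i 1 - axis j 1))
                      = regularized_form E x + t * L - t\<^sup>2"
    using regularized_form_move[OF ij(1,2)] by blast
  \<comment> \<open>Move all of the mass of one vertex to the other, in the direction in which the form does not
      increase to first order.\<close>
  define t where "t = (if L \<le> 0 then x $ j else - (x $ i))"
  define x' where "x' = x + t *\<^sub>R (axis i 1 - axis j 1)"
  have nth: "x' $ k = x $ k + (if k = i then t else 0) - (if k = j then t else 0)" for k
    by (auto simp: x'_def axis_def)
  have "t * L \<le> 0" "t \<noteq> 0"
    using pos by (auto simp: t_def mult_nonneg_nonpos)
  then have less: "regularized_form E x' < regularized_form E x"
    unfolding x'_def L by (smt (verit) zero_less_power2)
  have "0 \<le> x' $ k" for k
    using nonneg[of k] pos ij(1) by (auto simp: nth t_def)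
  moreover have "all_ones \<bullet> x' = 1"
    using x by (simp add: inner_all_ones nth std_simplex_def sum.distrib sum_subtractf)
  ultimately have "x' \<in> std_simplex"
    by (simp add: std_simplex_def)
  moreover have "{k. x' $ k \<noteq> 0} \<subset> {k. x $ k \<noteq> 0}"
  proof (rule psubsetI)
    show "{k. x' $ k \<noteq> 0} \<subseteq> {k. x $ k \<noteq> 0}"
      using ij by (auto simp: nth split: if_splits)
    have "x' $ i = 0 \<or> x' $ j = 0"
      using ij(1) by (simp add: nth t_def)
    then show "{k. x' $ k \<noteq> 0} \<noteq> {k. x $ k \<noteq> 0}"
      using ij(3,4) by blast
  qed
  ultimately show thesis
    using less that by blast
qed

lemma std_simplex_support_nonempty:
  assumes "x \<in> std_simplex"
  shows "{i. x $ i \<noteq> 0} \<noteq> {}"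
proof
  assume "{i. x $ i \<noteq> 0} = {}"
  then have "\<And>i. x $ i = 0"
    by blast
  then show False
    using assms by (simp add: std_simplex_def inner_all_ones)
qed

text \<open>
  Shrinking the support repeatedly leads to a clique, where the nonedge part vanishes and the
  squared norm is at least the reciprocal of the size of the support.
\<close>

theorem regularized_Motzkin_Straus:
  assumes "x \<in> std_simplex" and max: "\<And>C. clique E C \<Longrightarrow> card C \<le> m"
  shows "1 / (2 * real m) \<le> regularized_form E x"
  using assms(1)
proof (induction "card {i. x $ i \<noteq> 0}" arbitrary: x rule: less_induct)
  case less
  let ?S = "{i. x $ i \<noteq> 0}"
  show ?case
  proof (cases "clique E ?S")
    case True
    have S: "0 < card ?S" "card ?S \<le> m"
      using std_simplex_support_nonempty[OF less.prems] max[OF True] by (simp_all add: card_gt_0_iff)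
    have "0 \<le> x \<bullet> x - 1 / real (card ?S)"
      by (subst norm2_diff_char_vec[OF less.prems, symmetric])
        (use std_simplex_support_nonempty[OF less.prems] in auto)
    moreover have "1 / real m \<le> 1 / real (card ?S)"
      using S by (intro divide_left_mono) auto
    moreover have "nonedge_form E x = 0"
      by (rule nonedge_form_eq_0[OF True]) simp
    ultimately show ?thesis
      by (simp add: regularized_form_def)
  next
    case False
    obtain x' where x': "x' \<in> std_simplex" "{i. x' $ i \<noteq> 0} \<subset> ?S"
        "regularized_form E x' < regularized_form E x"
      using regularized_form_shrink_support[OF less.prems False] by blast
    then have "1 / (2 * real m) \<le> regularized_form E x'"
      by (intro less.hyps psubset_card_mono) auto
    then show ?thesis
      using x'(3) by simp
  qed
qed

text \<open>
  A minimizer is supported on a clique because shrinking the support is a strict decrease; there,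
  equality forces the barycentre of a clique of the largest possible size.
\<close>

theorem regularized_Motzkin_Straus_eq:
  assumes x: "x \<in> std_simplex" and max: "\<And>C. clique E C \<Longrightarrow> card C \<le> m"
    and eq: "regularized_form E x \<le> 1 / (2 * real m)"
  shows "\<exists>C. clique E C \<and> card C = m \<and> C \<noteq> {} \<and> x = char_vec C"
proof -
  let ?S = "{i. x $ i \<noteq> 0}"
  have clq: "clique E ?S"
  proof (rule ccontr)
    assume "\<not> clique E ?S"
    then obtain x' where "x' \<in> std_simplex" "regularized_form E x' < regularized_form E x"
      using regularized_form_shrink_support[OF x] by blast
    then show False
      using regularized_Motzkin_Straus[of x' E m] max eq by fastforce
  qed
  have ne: "?S \<noteq> {}"
    by (rule std_simplex_support_nonempty[OF x])
  then have S: "0 < card ?S" "card ?S \<le> m"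
    using max[OF clq] by (simp_all add: card_gt_0_iff)
  have diff: "(norm (x - char_vec ?S))\<^sup>2 = x \<bullet> x - 1 / real (card ?S)"
    by (rule norm2_diff_char_vec[OF x ne]) simp
  have "nonedge_form E x = 0"
    by (rule nonedge_form_eq_0[OF clq]) simp
  then have le: "x \<bullet> x \<le> 1 / real m"
    using eq by (simp add: regularized_form_def)
  moreover have inv: "1 / real m \<le> 1 / real (card ?S)"
    using S by (intro divide_left_mono) auto
  ultimately have "(norm (x - char_vec ?S))\<^sup>2 \<le> 0"
    using diff by simp
  then have 1: "x = char_vec ?S"
    by simp
  have "1 / real (card ?S) \<le> 1 / real m"
    using diff le by (smt (verit) zero_le_power2)
  then have "card ?S = m"
    using S by (simp add: field_simps)
  with 1 clq ne show ?thesis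
    by blast
qed

section \<open>Bounding the norm of the relaxed indicator\<close>

lemma norm2_eq_sum_squares: "(norm y)\<^sup>2 = (\<Sum>i\<in>UNIV. (y $ i)\<^sup>2)"
  for y :: "real^'n::finite"
  unfolding power2_norm_eq_inner by (simp add: inner_vec_def power2_eq_square)

text \<open>
  Two indices with \<open>y\<^sub>i\<^sup>2 > M\<close> and \<open>y\<^sub>j\<^sup>2 > M\<close> have \<open>y\<^sub>i y\<^sub>j > M\<close>, so these indices form a clique. They
  contribute at most 1 each, all others at most \<open>M\<close> each.
\<close>

lemma sum_squares_le:
  fixes y :: "real^'n::finite"
  assumes "\<And>i. 0 \<le> y $ i" and "\<And>i. y $ i \<le> 1" and "0 \<le> M"
    and "\<And>i j. i \<noteq> j \<Longrightarrow> {i, j} \<notin> E \<Longrightarrow> y $ i * y $ j \<le> M"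
    and "\<And>C. clique E C \<Longrightarrow> card C \<le> m"
  shows "(norm y)\<^sup>2 \<le> real m + real CARD('n) * M"
proof -
  let ?B = "{i. M < (y $ i)\<^sup>2}"
  have "clique E ?B"
    unfolding clique_def
  proof (intro ballI impI, rule ccontr)
    fix i j
    assume ij: "i \<in> ?B" "j \<in> ?B" "i \<noteq> j" "{i, j} \<notin> E"
    have "M * M < (y $ i)\<^sup>2 * (y $ j)\<^sup>2"
      using ij assms(3) by (intro mult_strict_mono') auto
    moreover have "(y $ i * y $ j) * (y $ i * y $ j) \<le> M * M"
      using ij assms by (intro mult_mono) auto
    ultimately show False
      by (simp add: power2_eq_square mult_ac)
  qed
  then have B: "card ?B \<le> m"
    by (rule assms(5))
  have "(norm y)\<^sup>2 = (\<Sum>i\<in>UNIV. (y $ i)\<^sup>2)"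
    by (rule norm2_eq_sum_squares)
  also have "\<dots> \<le> (\<Sum>i\<in>UNIV. (if i \<in> ?B then 1 else 0) + M)"
    using assms(1-3) by (intro sum_mono) (auto simp: power_le_one add_increasing2)
  also have "\<dots> = real (card ?B) + real CARD('n) * M"
    by (simp add: sum.distrib sum.If_cases)
  finally show ?thesis
    using B by linarith
qed

section \<open>The objective and the common graph\<close>

lemma E_bar_minus:
  assumes "U \<in> U_bar"
  shows "E_bar - U = nonadjacency_matrix (graph_of U)"
proof -
  obtain E where E: "simple_graph E" and U: "U = (1/2) *\<^sub>R mat 1 + adjacency_matrix E"
    using assms by (auto simp: U_bar_def)
  have "{i} \<notin> E" for i
    using E by (auto simp: simple_graph_def dest!: bspec)
  then show ?thesis
    unfolding U graph_of_adjacency[OF E]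
    by (simp add: vec_eq_iff E_bar_def E_mat_def all_ones_def mat_def
        adjacency_matrix_def nonadjacency_matrix_def)
qed

lemma g_eq:
  assumes "U \<in> U_bar" and "x \<in> std_simplex"
  shows "g \<beta> \<gamma> U x y =
    -1 + (x \<bullet> x) / 2 + (1 + \<beta>) * nonedge_form (graph_of U) x - 1 / (2 * \<gamma>) * (norm y)\<^sup>2"
proof -
  have "E_mat *v x = all_ones"
    using assms(2)
    by (simp add: E_mat_def matrix_vector_mult_def vec_eq_iff all_ones_def std_simplex_def inner_vec_def)
  then have "x \<bullet> (E_bar *v x) = 1 - (x \<bullet> x) / 2"
    using assms(2)
    by (simp add: E_bar_def matrix_vector_mult_diff_rdistrib scaleR_matrix_vector_assoc[symmetric]
        inner_diff_right std_simplex_def inner_commute)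
  moreover have "x \<bullet> ((E_bar - U) *v x) = nonedge_form (graph_of U) x"
    by (simp add: E_bar_minus[OF assms(1)] nonedge_form_def)
  ultimately show ?thesis
    by (simp add: g_def matrix_vector_mult_diff_rdistrib inner_diff_right algebra_simps)
qed

definition common_graph :: "(real^'n::finite^'n) set \<Rightarrow> 'n set set" where
  "common_graph \<U> = (\<Inter>U\<in>\<U>. graph_of U)"

lemma common_cliques_iff:
  "C \<in> common_cliques \<U> \<longleftrightarrow> C \<noteq> {} \<and> clique (common_graph \<U>) C"
  by (auto simp: common_cliques_def common_graph_def clique_def)

lemma maximum_common_clique_iff:
  "maximum_common_clique \<U> C \<longleftrightarrow>
     C \<noteq> {} \<and> clique (common_graph \<U>) C \<and> (\<forall>D. clique (common_graph \<U>) D \<longrightarrow> card D \<le> card C)"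
  unfolding maximum_common_clique_def is_arg_max_linorder common_cliques_iff
  by (metis card.empty le0)

lemma ex_maximum_common_clique:
  fixes \<U> :: "(real^'n::finite^'n) set"
  shows "\<exists>C. maximum_common_clique \<U> C"
proof -
  have "{undefined} \<in> common_cliques \<U>"
    by (simp add: common_cliques_iff clique_def)
  moreover have "\<forall>C. C \<in> common_cliques \<U> \<longrightarrow> card C < Suc CARD('n)"
    by (simp add: card_mono less_Suc_eq_le)
  ultimately show ?thesis
    unfolding maximum_common_clique_def is_arg_max_linorder
    using ex_has_greatest_nat[of "\<lambda>C. C \<in> common_cliques \<U>"] by blast
qed

lemma G_char_vec:
  assumes "\<U> \<noteq> {}" and "\<U> \<subseteq> U_bar" and "C \<in> common_cliques \<U>"
  shows "G \<U> \<beta> \<gamma> (char_vec C, y) = -1 + 1 / (2 * real (card C)) - 1 / (2 * \<gamma>) * (norm y)\<^sup>2"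
proof -
  have C: "C \<noteq> {}"
    using assms(3) by (simp add: common_cliques_def)
  have "g \<beta> \<gamma> U (char_vec C) y = -1 + 1 / (2 * real (card C)) - 1 / (2 * \<gamma>) * (norm y)\<^sup>2"
    if "U \<in> \<U>" for U
  proof -
    have "nonedge_form (graph_of U) (char_vec C) = 0"
      using assms(3) that by (intro nonedge_form_eq_0) (auto simp: common_cliques_def char_vec_nth)
    moreover have "U \<in> U_bar"
      using that assms(2) by blast
    ultimately show ?thesis
      using g_eq[OF _ char_vec_in_std_simplex[OF C]] char_vec_inner_self[OF C] by simp
  qed
  then have "(\<lambda>U. g \<beta> \<gamma> U (char_vec C) y) ` \<U>
      = {-1 + 1 / (2 * real (card C)) - 1 / (2 * \<gamma>) * (norm y)\<^sup>2}"
    using assms(1) by auto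
  then show ?thesis
    by (simp add: G_def)
qed

section \<open>The lower bound for the objective\<close>

text \<open>
  \<open>M\<close> is the largest product over a nonedge of the common graph, or 0 if that graph is complete.
  Every such nonedge is already missing in a single graph, so the maximum over \<open>\<U>\<close> can be replaced by
  one well-chosen \<open>U\<close>.
\<close>

lemma ex_dominant_conflict:
  fixes x :: "real^'n::finite"
  assumes "\<U> \<noteq> {}" and nonneg: "\<And>i. 0 \<le> x $ i"
  obtains M U where "0 \<le> M" "U \<in> \<U>" "2 * M \<le> nonedge_form (graph_of U) x"
    "\<And>i j. i \<noteq> j \<Longrightarrow> {i, j} \<notin> common_graph \<U> \<Longrightarrow> x $ i * x $ j \<le> M"
proof -
  let ?P = "{(i, j). i \<noteq> j \<and> {i, j} \<notin> common_graph \<U>}"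
  let ?f = "\<lambda>(i, j). x $ i * x $ j"
  show thesis
  proof (cases "?P = {}")
    case True
    obtain U where "U \<in> \<U>"
      using assms(1) by blast
    with True show thesis
      by (intro that[of 0 U]) (auto simp: nonedge_form_nonneg nonneg)
  next
    case False
    have fin: "finite (?f ` ?P)"
      by simp
    have "Max (?f ` ?P) \<in> ?f ` ?P"
      using Max_in[OF fin] False by blast
    then obtain p where p: "p \<in> ?P" "Max (?f ` ?P) = ?f p"
      by (rule imageE)
    obtain i j where "p = (i, j)"
      by (cases p)
    with p have ij: "(i, j) \<in> ?P" "Max (?f ` ?P) = x $ i * x $ j"
      by (simp_all only: prod.case)
    then obtain U where U: "U \<in> \<U>" "{i, j} \<notin> graph_of U"
      by (auto simp: common_graph_def)
    show thesis
    proof (rule that)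
      show "0 \<le> x $ i * x $ j"
        by (simp add: nonneg)
      show "2 * (x $ i * x $ j) \<le> nonedge_form (graph_of U) x"
        using ij(1) U(2) by (intro nonedge_form_ge_pair nonneg) auto
      show "x $ k * x $ l \<le> x $ i * x $ j" if "k \<noteq> l" "{k, l} \<notin> common_graph \<U>" for k l
        unfolding ij(2)[symmetric] using that by (intro Max_ge[OF fin]) force
    qed (rule U(1))
  qed
qed

text \<open>
  This is where the threshold for \<open>\<beta>\<close> comes from. Its first summand is calibrated so that
  \<open>(1 - 1/(2(n-1))) n\<^sup>2 \<ge> n(n - 1)\<close>, which amounts to \<open>n \<le> 2(n - 1)\<close>; for \<open>n = 1\<close> division by zero makes
  that summand 1, and there is no pair to pay for.
\<close>

lemma penalty_dominates:
  fixes n :: nat and \<beta> \<gamma> \<epsilon> M N :: real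
  assumes "1 \<le> n" and "0 < \<epsilon>" and "\<epsilon> \<le> 1 / real n" and "0 < \<gamma>" and "0 \<le> M" and "2 * M \<le> N"
    and \<beta>: "\<beta> > (1 - 1 / (2 * (real n - 1)) + 1 / (2 * \<gamma>) * real n) * (1 / (2 * \<epsilon>\<^sup>2))"
  shows "real n * (real n - 1) * M + 1 / (2 * \<gamma>) * (real n * (M / \<epsilon>\<^sup>2)) \<le> (1 + \<beta>) * N"
proof -
  define K where "K = 1 - 1 / (2 * (real n - 1))"
  define s where "s = 1 / \<epsilon>\<^sup>2"
  define c where "c = 1 / (2 * \<gamma>) * real n"
  have c: "0 \<le> c"
    using assms(4) by (simp add: c_def)
  have s0: "0 \<le> s"
    by (simp add: s_def)
  have "real n \<le> 1 / \<epsilon>"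
    using assms(1-3) by (simp add: field_simps)
  then have "(real n)\<^sup>2 \<le> (1 / \<epsilon>)\<^sup>2"
    by (intro power_mono) auto
  then have s: "(real n)\<^sup>2 \<le> s"
    by (simp add: s_def power_divide)
  have K: "0 \<le> K" and Kn: "real n * (real n - 1) \<le> K * s"
  proof -
    consider "n = 1" | "2 \<le> n"
      using assms(1) by linarith
    then have "0 \<le> K \<and> real n * (real n - 1) \<le> K * (real n)\<^sup>2"
    proof cases
      case 1
      then show ?thesis by (simp add: K_def)
    next
      case 2
      then have "1 \<le> real n - 1"
        by linarith
      then have "1 / (2 * (real n - 1)) \<le> 1 / real n" "1 / (2 * (real n - 1)) \<le> 1 / 2"
        using 2 by (auto intro!: divide_left_mono)
      then have "0 \<le> K" "1 - 1 / real n \<le> K"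
        by (simp_all add: K_def)
      moreover have "(1 - 1 / real n) * (real n)\<^sup>2 = real n * (real n - 1)"
        using 2 by (simp add: field_simps power2_eq_square)
      ultimately show ?thesis
        by (metis mult_right_mono zero_le_power2)
    qed
    then show "0 \<le> K" "real n * (real n - 1) \<le> K * s"
      using s by (auto intro: order_trans mult_left_mono)
  qed
  have "(K + c) * (1 / (2 * \<epsilon>\<^sup>2)) \<le> \<beta>"
    using \<beta> unfolding K_def c_def by (rule less_imp_le)
  moreover have "a * s = 2 * (a * (1 / (2 * \<epsilon>\<^sup>2)))" for a
    by (simp add: s_def)
  ultimately have b1: "(K + c) * s \<le> 2 * \<beta>"
    by (metis mult_left_mono zero_le_numeral)
  have "0 \<le> (K + c) * s"
    using K c s0 by simp
  with b1 have b2: "0 \<le> \<beta>"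
    by linarith
  have "real n * (real n - 1) * M + c * (s * M) \<le> (K * s + c * s) * M"
    using mult_right_mono[OF Kn assms(5)] by (simp add: algebra_simps)
  also have "\<dots> \<le> (2 * \<beta>) * M"
    using b1 assms(5) by (intro mult_right_mono) (auto simp: algebra_simps)
  also have "\<dots> \<le> (1 + \<beta>) * (2 * M)"
    using assms(5) by (simp add: algebra_simps)
  also have "\<dots> \<le> (1 + \<beta>) * N"
    using b2 assms(6) by (intro mult_left_mono) auto
  finally show ?thesis
    by (simp add: c_def s_def)
qed

text \<open>
  The bound separates the variables: what remains of \<open>x\<close> is the Motzkin-Straus form of the common
  graph, and what remains of \<open>y\<close> is the constant \<open>m\<close>.
\<close>

lemma G_lower_bound:
  fixes \<U> :: "(real^'n::finite^'n) set"
  assumes ne: "\<U> \<noteq> {}" and sub: "\<U> \<subseteq> U_bar"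
    and \<epsilon>: "0 < \<epsilon>" "\<epsilon> \<le> 1 / real CARD('n)" and \<gamma>: "0 < \<gamma>"
    and \<beta>: "\<beta> > (1 - 1 / (2 * (real CARD('n) - 1)) + 1 / (2 * \<gamma>) * real CARD('n)) * (1 / (2 * \<epsilon>\<^sup>2))"
    and xy: "(x, y) \<in> Delta \<epsilon>"
    and max: "\<And>C. clique (common_graph \<U>) C \<Longrightarrow> card C \<le> m"
  shows "-1 + regularized_form (common_graph \<U>) x - 1 / (2 * \<gamma>) * real m \<le> G \<U> \<beta> \<gamma> (x, y)"
proof -
  let ?H = "common_graph \<U>"
  have x: "x \<in> std_simplex" and xy': "\<epsilon> * y $ i \<le> x $ i" "0 \<le> y $ i" "y $ i \<le> 1" for i
    using xy by (auto simp: Delta_def)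
  have nonneg: "0 \<le> x $ i" for i
    using x by (simp add: std_simplex_def)
  obtain M U where M: "0 \<le> M" and U: "U \<in> \<U>" and N: "2 * M \<le> nonedge_form (graph_of U) x"
    and le: "\<And>i j. i \<noteq> j \<Longrightarrow> {i, j} \<notin> ?H \<Longrightarrow> x $ i * x $ j \<le> M"
    using ex_dominant_conflict[OF ne, of x] nonneg by metis
  have NH: "nonedge_form ?H x \<le> real CARD('n) * (real CARD('n) - 1) * M"
    by (rule nonedge_form_le[OF le M])
  have "(norm y)\<^sup>2 \<le> real m + real CARD('n) * (M / \<epsilon>\<^sup>2)"
  proof (rule sum_squares_le[where E = ?H])
    show "y $ i * y $ j \<le> M / \<epsilon>\<^sup>2" if "i \<noteq> j" "{i, j} \<notin> ?H" for i j
    proof -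
      have "(\<epsilon> * y $ i) * (\<epsilon> * y $ j) \<le> x $ i * x $ j"
        using xy' nonneg \<epsilon>(1) by (intro mult_mono) auto
      also have "\<dots> \<le> M"
        by (rule le[OF that])
      finally show ?thesis
        using \<epsilon>(1) by (simp add: field_simps power2_eq_square)
    qed
  qed (use xy' M max in auto)
  then have "1 / (2 * \<gamma>) * (norm y)\<^sup>2 \<le> 1 / (2 * \<gamma>) * (real m + real CARD('n) * (M / \<epsilon>\<^sup>2))"
    using \<gamma> by (intro mult_left_mono) auto
  moreover have "real CARD('n) * (real CARD('n) - 1) * M + 1 / (2 * \<gamma>) * (real CARD('n) * (M / \<epsilon>\<^sup>2))
      \<le> (1 + \<beta>) * nonedge_form (graph_of U) x"
    by (rule penalty_dominates[OF _ \<epsilon> \<gamma> M N \<beta>]) (simp add: Suc_le_eq)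
  ultimately have "-1 + regularized_form ?H x - 1 / (2 * \<gamma>) * real m \<le> g \<beta> \<gamma> U x y"
    using NH U sub by (subst g_eq[OF _ x]) (auto simp: regularized_form_def distrib_left)
  also have "\<dots> \<le> G \<U> \<beta> \<gamma> (x, y)"
  proof -
    have "finite \<U>"
      using sub finite_U_bar finite_subset by blast
    then show ?thesis
      using U by (simp add: G_def)
  qed
  finally show ?thesis .
qed

section \<open>Stable global minimizers\<close>

lemma Delta_char_vec_D:
  assumes "(char_vec C, y) \<in> Delta \<epsilon>" and "0 < \<epsilon>" and "i \<notin> C"
  shows "y $ i = 0"
proof -
  have "\<epsilon> * y $ i \<le> 0" "0 \<le> y $ i"
    using assms(1,3) by (auto simp: Delta_def char_vec_nth dest: spec[of _ i])
  then show ?thesis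
    using assms(2) by (simp add: mult_le_0_iff)
qed

lemma Delta_char_vec_indicator:
  fixes C :: "'n::finite set"
  assumes "C \<noteq> {}" and "0 < \<epsilon>" and "\<epsilon> \<le> 1 / real CARD('n)"
  shows "(char_vec C, \<chi> i. if i \<in> C then 1 else 0) \<in> Delta \<epsilon>"
proof -
  have c: "0 < card C" "card C \<le> CARD('n)"
    using assms(1) by (simp_all add: card_gt_0_iff card_mono)
  then have "1 / real CARD('n) \<le> 1 / real (card C)"
    by (intro divide_left_mono) auto
  then show ?thesis
    using assms c by (auto simp: Delta_def char_vec_in_std_simplex char_vec_nth)
qed

text \<open>
  For \<open>y\<close> in the unit cube the sum is nonnegative and vanishes only if \<open>y\<close> is the indicator of \<open>C\<close>, so it
  measures how far the norm falls short of its maximum.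
\<close>

lemma norm2_supported:
  fixes y :: "real^'n::finite"
  assumes "\<And>i. i \<notin> C \<Longrightarrow> y $ i = 0"
  shows "(norm y)\<^sup>2 = real (card C) - (\<Sum>i\<in>C. 1 - (y $ i)\<^sup>2)"
proof -
  have "(norm y)\<^sup>2 = (\<Sum>i\<in>UNIV. (y $ i)\<^sup>2)"
    by (rule norm2_eq_sum_squares)
  also have "\<dots> = (\<Sum>i\<in>C. (y $ i)\<^sup>2)"
    using assms by (intro sum.mono_neutral_right) auto
  finally show ?thesis
    by (simp add: sum_subtractf)
qed

theorem theorem2:
  fixes \<U> :: "(real^'n::finite^'n) set"
    and \<epsilon> \<gamma> :: real
    and \<beta> :: "real \<Rightarrow> real"
    and x y :: "real^'n"
  assumes "\<U> \<noteq> {}" and "\<U> \<subseteq> U_bar"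
    and "0 < \<epsilon>" and "\<epsilon> \<le> 1 / real CARD('n)"
    and "0 < \<gamma>"
    and "\<And>\<delta>. 0 \<le> \<delta> \<Longrightarrow> \<delta> < \<epsilon> \<Longrightarrow>
           \<beta> (\<epsilon> - \<delta>) > (1 - 1 / (2 * (real CARD('n) - 1)) + 1 / (2 * \<gamma>) * real CARD('n))
                        * (1 / (2 * (\<epsilon> - \<delta>)\<^sup>2))"
    and "(x, y) \<in> Delta \<epsilon>"
  shows "stable_global_minimizer \<U> \<beta> \<gamma> \<epsilon> (x, y) \<longleftrightarrow>
           (\<exists>C. maximum_common_clique \<U> C \<and> x = char_vec C) \<and> (\<forall>i. y $ i \<in> {0, 1})"
proof
  assume "stable_global_minimizer \<U> \<beta> \<gamma> \<epsilon> (x, y)"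
  then obtain \<delta>' where "\<delta>' > 0"
    and "\<forall>\<delta>\<in>{0..\<delta>'}. is_arg_min (G \<U> (\<beta> (\<epsilon> - \<delta>)) \<gamma>) (\<lambda>q. q \<in> Delta (\<epsilon> - \<delta>)) (x, y)"
    unfolding stable_global_minimizer_def by blast
  then have "is_arg_min (G \<U> (\<beta> (\<epsilon> - 0)) \<gamma>) (\<lambda>q. q \<in> Delta (\<epsilon> - 0)) (x, y)"
    by (meson atLeastAtMost_iff less_imp_le order_refl)
  then have min: "G \<U> (\<beta> \<epsilon>) \<gamma> (x, y) \<le> G \<U> (\<beta> \<epsilon>) \<gamma> q" if "q \<in> Delta \<epsilon>" for q
    using that unfolding is_arg_min_linorder diff_zero by blast
  obtain D where "maximum_common_clique \<U> D"
    using ex_maximum_common_clique by blast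
  then have D: "D \<noteq> {}" "D \<in> common_cliques \<U>"
    and max: "\<And>C. clique (common_graph \<U>) C \<Longrightarrow> card C \<le> card D"
    by (auto simp: maximum_common_clique_iff common_cliques_iff)
  let ?m = "real (card D)"
  let ?z = "\<chi> i. if i \<in> D then 1 else (0::real)"
  have "(norm ?z)\<^sup>2 = ?m"
    by (subst norm2_supported[of D]) auto
  then have le: "G \<U> (\<beta> \<epsilon>) \<gamma> (x, y) \<le> -1 + 1 / (2 * ?m) - 1 / (2 * \<gamma>) * ?m"
    using min[OF Delta_char_vec_indicator[OF D(1) assms(3,4)]]
    by (simp add: G_char_vec[OF assms(1,2) D(2)])
  have "-1 + regularized_form (common_graph \<U>) x - 1 / (2 * \<gamma>) * ?m \<le> G \<U> (\<beta> \<epsilon>) \<gamma> (x, y)"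
    using assms(6)[of 0] assms(3)
    by (intro G_lower_bound[OF assms(1-5) _ assms(7) max]) simp_all
  \<comment> \<open>The upper and the lower bound share the term in \<open>m\<close>, so \<open>x\<close> minimizes the Motzkin-Straus form.\<close>
  with le have "regularized_form (common_graph \<U>) x \<le> 1 / (2 * ?m)"
    by linarith
  moreover have "x \<in> std_simplex"
    using assms(7) by (simp add: Delta_def)
  ultimately obtain C where C: "clique (common_graph \<U>) C" "card C = card D" "C \<noteq> {}" "x = char_vec C"
    using regularized_Motzkin_Straus_eq max by blast
  have y0: "y $ i = 0" if "i \<notin> C" for i
    using Delta_char_vec_D[of C y \<epsilon>] assms(3,7) C(4) that by simp
  have y1: "(y $ i)\<^sup>2 \<le> 1" for i
    using assms(7) by (auto simp: Delta_def power_le_one)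
  have "C \<in> common_cliques \<U>"
    using C by (simp add: common_cliques_iff)
  then have "1 / (2 * \<gamma>) * ?m \<le> 1 / (2 * \<gamma>) * (norm y)\<^sup>2"
    using le C(2,4) by (simp add: G_char_vec[OF assms(1,2)])
  then have "?m \<le> (norm y)\<^sup>2"
    using assms(5) by (simp add: divide_le_cancel)
  then have "(\<Sum>i\<in>C. 1 - (y $ i)\<^sup>2) \<le> 0"
    using norm2_supported[of C y] y0 C(2) by simp
  then have "(\<Sum>i\<in>C. 1 - (y $ i)\<^sup>2) = 0"
    using y1 by (intro antisym sum_nonneg) auto
  then have "\<forall>i\<in>C. 1 - (y $ i)\<^sup>2 = 0"
    using y1 by (subst (asm) sum_nonneg_eq_0_iff) auto
  moreover have "0 \<le> y $ i" for i
    using assms(7) by (simp add: Delta_def)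
  ultimately have "y $ i \<in> {0, 1}" for i
    using y0[of i] by (cases "i \<in> C") (auto simp: power2_eq_1_iff dest!: bspec, smt (verit))
  moreover have "maximum_common_clique \<U> C"
    using C max by (simp add: maximum_common_clique_iff)
  ultimately show "(\<exists>C. maximum_common_clique \<U> C \<and> x = char_vec C) \<and> (\<forall>i. y $ i \<in> {0, 1})"
    using C(4) by blast
next
  assume "(\<exists>C. maximum_common_clique \<U> C \<and> x = char_vec C) \<and> (\<forall>i. y $ i \<in> {0, 1})"
  then obtain C where C: "maximum_common_clique \<U> C" "x = char_vec C" and y01: "\<And>i. y $ i \<in> {0, 1}"
    by blast
  then have ne: "C \<noteq> {}" and cc: "C \<in> common_cliques \<U>"
    and max: "\<And>D. clique (common_graph \<U>) D \<Longrightarrow> card D \<le> card C"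
    by (auto simp: maximum_common_clique_iff common_cliques_iff)
  let ?m = "real (card C)"
  have y0: "y $ i = 0" if "i \<notin> C" for i
    using Delta_char_vec_D[of C y \<epsilon>] assms(3,7) C(2) that by simp
  have y1: "y $ i = 1" if "i \<in> C" for i
  proof -
    have "0 < x $ i" "x $ i \<le> y $ i"
      using assms(7) that by (auto simp: C(2) char_vec_nth card_gt_0_iff Delta_def dest!: spec[of _ i])
    then show ?thesis
      using y01[of i] by auto
  qed
  have y: "y = (\<chi> i. if i \<in> C then 1 else 0)"
    by (simp add: vec_eq_iff y0 y1)
  have ny: "(norm y)\<^sup>2 = ?m"
    by (subst norm2_supported[of C]) (auto simp: y0 y1)
  show "stable_global_minimizer \<U> \<beta> \<gamma> \<epsilon> (x, y)"
    unfolding stable_global_minimizer_def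
  \<comment> \<open>Any positive radius below \<open>\<epsilon>\<close> would do, since the minimal value is the same for all \<open>\<epsilon> - \<delta> > 0\<close>.\<close>
  proof (intro exI[of _ "\<epsilon> / 2"] conjI ballI)
    fix \<delta>
    assume "\<delta> \<in> {0..\<epsilon> / 2}"
    then have \<delta>: "0 \<le> \<delta>" "\<delta> < \<epsilon>" "0 < \<epsilon> - \<delta>" "\<epsilon> - \<delta> \<le> 1 / real CARD('n)"
      using assms(3,4) by auto
    have "G \<U> (\<beta> (\<epsilon> - \<delta>)) \<gamma> (x, y) \<le> G \<U> (\<beta> (\<epsilon> - \<delta>)) \<gamma> (x', y')"
      if "(x', y') \<in> Delta (\<epsilon> - \<delta>)" for x' y'
    proof -
      have "1 / (2 * ?m) \<le> regularized_form (common_graph \<U>) x'"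
        using that max by (intro regularized_Motzkin_Straus) (auto simp: Delta_def)
      moreover have "-1 + regularized_form (common_graph \<U>) x' - 1 / (2 * \<gamma>) * ?m
          \<le> G \<U> (\<beta> (\<epsilon> - \<delta>)) \<gamma> (x', y')"
        by (rule G_lower_bound[OF assms(1,2) \<delta>(3,4) assms(5) assms(6)[OF \<delta>(1,2)] that max])
      ultimately show ?thesis
        by (simp add: C(2) G_char_vec[OF assms(1,2) cc] ny)
    qed
    then show "is_arg_min (G \<U> (\<beta> (\<epsilon> - \<delta>)) \<gamma>) (\<lambda>q. q \<in> Delta (\<epsilon> - \<delta>)) (x, y)"
      unfolding is_arg_min_linorder
      using Delta_char_vec_indicator[OF ne \<delta>(3,4)] y C(2) by auto
  qed (use assms(3) in auto)
qed

end
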